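(* Let $p\in M$, let $U$ be an open subset of the fiber $T_pM$ with linear coordinates $v^1,\dots,v^n$, and let $\mathbf A_0=\mathbf L=\sum_{i=1}^n L_i\,dv^i$ and $\mathbf A_1=\mathbf A=\sum_{i=1}^n A_i\,dv^i$ be smooth differential $1$-forms on $U$, with $\mathbf L$ nowhere zero on $U$, satisfying $$d\,\mathbf L=\mathbf L\wedge\mathbf A .$$ Then this equation leads to the following infinite series of compatibility conditions: there exist smooth $1$-forms $\mathbf A_2,\mathbf A_3,\mathbf A_4,\dots$ on $U$ such that for all $k\ge 0$ $$d\,\mathbf A_k=\sum_{i=0}^{[k/2]}C^i_{k+1}\,\mathbf A_i\wedge\mathbf A_{k+1-i},$$ where $[k/2]$ is the integer part of $k/2$, $C^0_1=1$, and for all $k\ge2$ and integers $i$ with $0\le 2i<k$ $$C^i_k=\prod_{s=1}^{i}\frac{k-1-s}{s}-\prod_{s=1}^{k-i}\frac{k-1-s}{s}.$$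
   Context: $M$ is a smooth manifold of dimension $n\ge 3$. All forms are differential forms within a single fixed fiber $T_pM$ of the tangent bundle, and $d$ is exterior differentiation with respect to the fiber coordinates $v^1,\dots,v^n$ only (the base point $p$ is fixed). An empty product equals $1$. *)

theory Defs
  imports "HOL-Analysis.Analysis"
begin

(* The fiber T_pM is identified with real^'n by its linear coordinates v^1, ..., v^n, where
   n = CARD('n).  Tangent vectors to the fiber are again elements of real^'n. *)

type_synonym 'n covector = "(real^'n) \<Rightarrow>\<^sub>L real"
type_synonym 'n one_form = "real^'n \<Rightarrow> 'n covector"
type_synonym 'n two_form = "real^'n \<Rightarrow> real^'n \<Rightarrow> real^'n \<Rightarrow> real"

(* C^k on an open set S: for k > 0, f is differentiable on S and all its directional
   derivatives are C^(k-1).  In finite dimension this is the usual notion. *)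
primrec Ck_on :: "nat \<Rightarrow> ('a::euclidean_space \<Rightarrow> 'b::real_normed_vector) \<Rightarrow> 'a set \<Rightarrow> bool" where
  "Ck_on 0 f S \<longleftrightarrow> continuous_on S f"
| "Ck_on (Suc k) f S \<longleftrightarrow> (\<forall>v\<in>S. f differentiable (at v)) \<and>
     (\<forall>h. Ck_on k (\<lambda>v. frechet_derivative f (at v) h) S)"

definition smooth_on :: "('a::euclidean_space \<Rightarrow> 'b::real_normed_vector) \<Rightarrow> 'a set \<Rightarrow> bool" where
  "smooth_on f S \<longleftrightarrow> (\<forall>k. Ck_on k f S)"

lift_definition dv :: "'n::finite \<Rightarrow> 'n covector" is "\<lambda>i x. x $ i"
  by (rule bounded_linear_vec_nth)

definition coeff :: "'n::finite one_form \<Rightarrow> 'n \<Rightarrow> real^'n \<Rightarrow> real" where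
  "coeff \<omega> i v = \<omega> v (axis i 1)"

lemma one_form_expansion:
  fixes \<omega> :: "'n::finite one_form"
  shows "\<omega> v = (\<Sum>i\<in>UNIV. coeff \<omega> i v *\<^sub>R dv i)"
proof (rule blinfun_eqI)
  fix x :: "real^'n"
  have "\<omega> v x = \<omega> v (\<Sum>i\<in>UNIV. x $ i *\<^sub>R axis i 1)"
    by (simp add: basis_expansion flip: scalar_mult_eq_scaleR)
  also have "\<dots> = (\<Sum>i\<in>UNIV. coeff \<omega> i v *\<^sub>R dv i) x"
    by (simp add: blinfun.sum_right blinfun.scaleR_right blinfun.sum_left blinfun.scaleR_left
        coeff_def dv.rep_eq mult.commute)
  finally show "\<omega> v x = (\<Sum>i\<in>UNIV. coeff \<omega> i v *\<^sub>R dv i) x" .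
qed

definition smooth_one_form :: "'n::finite one_form \<Rightarrow> (real^'n) set \<Rightarrow> bool" where
  "smooth_one_form \<omega> U \<longleftrightarrow> (\<forall>i. smooth_on (coeff \<omega> i) U)"

definition covector_wedge ::
  "'n::finite covector \<Rightarrow> 'n covector \<Rightarrow> real^'n \<Rightarrow> real^'n \<Rightarrow> real" where
  "covector_wedge \<alpha> \<beta> x y = \<alpha> x * \<beta> y - \<beta> x * \<alpha> y"

definition wedge :: "'n::finite one_form \<Rightarrow> 'n one_form \<Rightarrow> 'n two_form" where
  "wedge \<alpha> \<beta> v = covector_wedge (\<alpha> v) (\<beta> v)"

definition partial_deriv :: "'n::finite \<Rightarrow> (real^'n \<Rightarrow> real) \<Rightarrow> real^'n \<Rightarrow> real" where
  "partial_deriv j f v = frechet_derivative f (at v) (axis j 1)"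

(* d (sum_i w_i dv^i) = sum_i dw_i \<and> dv^i = sum_i sum_j (dw_i / dv^j) dv^j \<and> dv^i *)
definition ext_deriv :: "'n::finite one_form \<Rightarrow> 'n two_form" where
  "ext_deriv \<omega> v x y =
     (\<Sum>i\<in>UNIV. \<Sum>j\<in>UNIV. partial_deriv j (coeff \<omega> i) v * covector_wedge (dv j) (dv i) x y)"

(* C^i_k is meant for k \<ge> 1 and 2i < k; for k = 1 (hence i = 0) the general formula would give 2
   and the value is set to 1 instead. *)
definition C_coeff :: "nat \<Rightarrow> nat \<Rightarrow> real" where
  "C_coeff k i =
     (if k = 1 then 1
      else (\<Prod>s=1..i. (real k - 1 - real s) / real s)
         - (\<Prod>s=1..k-i. (real k - 1 - real s) / real s))"

end

theory Submission
  imports Defs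
begin

text \<open>
  By \<open>C_coeff (k + 1) i = (k choose i) - (k choose (k + 1 - i))\<close>, the right-hand side is the folded
  form of \<open>\<Sum>m\<le>k. (k choose m) A\<^sub>m \<and> A\<^bsub>k+1-m\<^esub>\<close>, so in terms of the formal series
  \<open>\<omega>(t) = \<Sum>k. A\<^sub>k t\<^sup>k / k!\<close> the whole system is the single equation \<open>d\<omega> = \<omega> \<and> \<omega>'\<close>.

  Suppose it holds up to order \<open>n\<close>, and let \<open>E = d\<omega> - \<omega> \<and> \<omega>'\<close>.  Applying \<open>d\<close> gives
  \<open>dE = E' \<and> \<omega> - E \<and> \<omega>'\<close>, whose coefficient of \<open>t\<^sup>n\<close> reduces to \<open>L \<and> E\<^bsub>n+1\<^esub> = 0\<close>.
  As \<open>L\<close> has no zeros, \<open>E\<^bsub>n+1\<^esub> = L \<and> B\<close> for a smooth \<open>B\<close>, and adding a multiple of \<open>B\<close> to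
  \<open>A\<^bsub>n+2\<^esub>\<close> extends the equation to order \<open>n + 1\<close> without affecting the lower orders.
\<close>

section \<open>Smooth functions\<close>

text \<open>A derivative at a point depends only on values near it, so openness of \<open>S\<close>
  lets agreement on \<open>S\<close> pass to all derivatives.\<close>

lemma Ck_on_cong:
  assumes "open S" "\<And>x. x \<in> S \<Longrightarrow> f x = g x" "Ck_on k f S"
  shows "Ck_on k g S"
  using assms(2,3)
proof (induction k arbitrary: f g)
  case 0
  then show ?case by (simp cong: continuous_on_cong)
next
  case (Suc k)
  have *: "(g has_derivative frechet_derivative f (at v)) (at v)" if "v \<in> S" for v
  proof (rule has_derivative_transform_within_open[OF _ \<open>open S\<close> that])
    show "(f has_derivative frechet_derivative f (at v)) (at v)"
      using Suc.prems that by (simp add: frechet_derivative_works[symmetric])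
  qed (use Suc.prems in simp)
  then have eq: "frechet_derivative f (at v) = frechet_derivative g (at v)" if "v \<in> S" for v
    using that by (metis frechet_derivative_at)
  have "Ck_on k (\<lambda>v. frechet_derivative g (at v) h) S" for h
  proof (rule Suc.IH)
    show "Ck_on k (\<lambda>v. frechet_derivative f (at v) h) S"
      using Suc.prems by simp
  qed (simp add: eq)
  then show ?case
    using * by (auto simp: differentiable_def)
qed

text \<open>By uniqueness of derivatives, any explicit formula for the derivative may replace
  \<open>frechet_derivative\<close>.\<close>

lemma Ck_on_SucI:
  assumes "open S" "\<And>v. v \<in> S \<Longrightarrow> (f has_derivative f' v) (at v)" "\<And>h. Ck_on k (\<lambda>v. f' v h) S"
  shows "Ck_on (Suc k) f S"
proof -
  have "f' v = frechet_derivative f (at v)" if "v \<in> S" for v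
    using assms(2)[OF that] by (rule frechet_derivative_at)
  then have "Ck_on k (\<lambda>v. frechet_derivative f (at v) h) S" for h
    by (intro Ck_on_cong[OF \<open>open S\<close> _ assms(3)[of h]]) simp
  then show ?thesis
    using assms(2) by (auto simp: differentiable_def)
qed

lemma Ck_on_SucD:
  assumes "open S" "Ck_on (Suc k) f S"
  shows "Ck_on k f S"
  using assms(2)
proof (induction k arbitrary: f)
  case 0
  then have "continuous (at v) f" if "v \<in> S" for v
    using that by (simp add: differentiable_imp_continuous_within)
  then show ?case
    by (simp add: continuous_at_imp_continuous_on)
next
  case (Suc k)
  then have "\<forall>h. Ck_on k (\<lambda>v. frechet_derivative f (at v) h) S"
    by (auto simp del: Ck_on.simps simp: Ck_on.simps(2)[of "Suc k" f])
  then show ?case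
    using Suc.prems by simp
qed

lemma Ck_on_derivative:
  "Ck_on (Suc k) f S \<Longrightarrow> v \<in> S \<Longrightarrow> (f has_derivative frechet_derivative f (at v)) (at v)"
  by (simp add: frechet_derivative_works[symmetric])

lemma Ck_on_const:
  assumes "open S"
  shows "Ck_on k (\<lambda>x. c) S"
proof (induction k arbitrary: c)
  case (Suc k)
  show ?case
    by (rule Ck_on_SucI[OF assms, where f' = "\<lambda>v h. 0"]) (auto simp: Suc)
qed simp

lemma Ck_on_add:
  assumes "open S" "Ck_on k f S" "Ck_on k g S"
  shows "Ck_on k (\<lambda>x. f x + g x) S"
  using assms(2,3)
proof (induction k arbitrary: f g)
  case 0
  then show ?case by (simp add: continuous_on_add)
next
  case (Suc k)
  then show ?case
    by (intro Ck_on_SucI[OF assms(1) has_derivative_add[OF Ck_on_derivative[OF Suc.prems(1)]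
          Ck_on_derivative[OF Suc.prems(2)]]] Suc.IH) auto
qed

lemma Ck_on_mult:
  fixes f g :: "'a::euclidean_space \<Rightarrow> 'b::real_normed_algebra"
  assumes "open S" "Ck_on k f S" "Ck_on k g S"
  shows "Ck_on k (\<lambda>x. f x * g x) S"
  using assms(2,3)
proof (induction k arbitrary: f g)
  case 0
  then show ?case by (simp add: continuous_on_mult)
next
  case (Suc k)
  \<comment> \<open>The product rule leaves one factor undifferentiated, so the factors themselves
    are needed at order \<open>k\<close>.\<close>
  have "Ck_on k f S" "Ck_on k g S"
    using Suc.prems assms(1) by (blast intro: Ck_on_SucD)+
  then show ?case
    using Suc.prems
    by (intro Ck_on_SucI[OF assms(1) has_derivative_mult[OF Ck_on_derivative[OF Suc.prems(1)]
          Ck_on_derivative[OF Suc.prems(2)]]] Ck_on_add Suc.IH assms(1)) auto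
qed

text \<open>The derivative of 1/f is -(1/f) f' (1/f), in which 1/f occurs undifferentiated, so the
  induction on \<open>k\<close> closes.\<close>

lemma Ck_on_inverse:
  fixes f :: "'a::euclidean_space \<Rightarrow> 'b::real_normed_div_algebra"
  assumes "open S" "Ck_on k f S" "\<And>x. x \<in> S \<Longrightarrow> f x \<noteq> 0"
  shows "Ck_on k (\<lambda>x. inverse (f x)) S"
  using assms(2)
proof (induction k)
  case 0
  then show ?case using assms(3) by (auto intro!: continuous_on_inverse)
next
  case (Suc k)
  have "Ck_on k (\<lambda>x. inverse (f x)) S"
    using Suc assms(1) by (blast intro: Ck_on_SucD)
  then have "Ck_on k (\<lambda>v. (- 1) * (inverse (f v) * frechet_derivative f (at v) h * inverse (f v))) S" for h
    using Suc.prems by (intro Ck_on_mult Ck_on_const assms(1)) auto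
  then have "Ck_on k (\<lambda>v. - (inverse (f v) * frechet_derivative f (at v) h * inverse (f v))) S" for h
    by simp
  then show ?case
    by (intro Ck_on_SucI[OF assms(1) Deriv.has_derivative_inverse[OF assms(3) Ck_on_derivative[OF Suc.prems]]])
qed

lemma smooth_on_const: "open S \<Longrightarrow> smooth_on (\<lambda>x. c) S"
  by (simp add: smooth_on_def Ck_on_const)

lemma smooth_on_add:
  "open S \<Longrightarrow> smooth_on f S \<Longrightarrow> smooth_on g S \<Longrightarrow> smooth_on (\<lambda>x. f x + g x) S"
  by (simp add: smooth_on_def Ck_on_add)

lemma smooth_on_mult:
  fixes f g :: "'a::euclidean_space \<Rightarrow> 'b::real_normed_algebra"
  shows "open S \<Longrightarrow> smooth_on f S \<Longrightarrow> smooth_on g S \<Longrightarrow> smooth_on (\<lambda>x. f x * g x) S"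
  by (simp add: smooth_on_def Ck_on_mult)

lemma smooth_on_diff:
  fixes f g :: "'a::euclidean_space \<Rightarrow> 'b::real_normed_algebra_1"
  assumes "open S" "smooth_on f S" "smooth_on g S"
  shows "smooth_on (\<lambda>x. f x - g x) S"
  using smooth_on_add[OF assms(1,2) smooth_on_mult[OF assms(1) smooth_on_const[OF assms(1), of "- 1"] assms(3)]]
  by simp

lemma smooth_on_sum:
  assumes "open S" "\<And>i. i \<in> I \<Longrightarrow> smooth_on (f i) S"
  shows "smooth_on (\<lambda>x. \<Sum>i\<in>I. f i x) S"
  using assms(2) by (induction I rule: infinite_finite_induct)
    (auto intro: smooth_on_const smooth_on_add assms(1))

lemma smooth_on_inverse:
  fixes f :: "'a::euclidean_space \<Rightarrow> 'b::real_normed_div_algebra"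
  shows "open S \<Longrightarrow> smooth_on f S \<Longrightarrow> (\<And>x. x \<in> S \<Longrightarrow> f x \<noteq> 0) \<Longrightarrow> smooth_on (\<lambda>x. inverse (f x)) S"
  by (simp add: smooth_on_def Ck_on_inverse)

lemma smooth_on_frechet_derivative:
  "smooth_on f S \<Longrightarrow> smooth_on (\<lambda>v. frechet_derivative f (at v) h) S"
  unfolding smooth_on_def by (metis Ck_on.simps(2))

lemma smooth_on_differentiable: "smooth_on f S \<Longrightarrow> v \<in> S \<Longrightarrow> f differentiable (at v)"
  unfolding smooth_on_def by (metis Ck_on.simps(2))

lemma smooth_on_continuous: "smooth_on f S \<Longrightarrow> continuous_on S f"
  unfolding smooth_on_def by (metis Ck_on.simps(1))

section \<open>Symmetry of second derivatives\<close>

text \<open>The second difference over a parallelogram is an increment of increments: the mean value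
  theorem along \<open>h\<close>, then along \<open>k\<close>, turns it into a mixed
  derivative.\<close>

lemma second_difference_mvt:
  fixes f :: "'a::real_normed_vector \<Rightarrow> real"
  defines "D \<equiv> \<lambda>f h v. frechet_derivative f (at v) h"
  assumes "0 < t"
    and S: "\<And>\<sigma> \<tau>. \<sigma> \<in> {0..t} \<Longrightarrow> \<tau> \<in> {0..t} \<Longrightarrow> v + \<sigma> *\<^sub>R h + \<tau> *\<^sub>R k \<in> S"
    and f: "\<And>x. x \<in> S \<Longrightarrow> f differentiable (at x)"
    and Df: "\<And>x. x \<in> S \<Longrightarrow> D f h differentiable (at x)"
  obtains \<sigma> \<tau> where "\<sigma> \<in> {0..t}" "\<tau> \<in> {0..t}"
    "f (v + t *\<^sub>R h + t *\<^sub>R k) - f (v + t *\<^sub>R h) - f (v + t *\<^sub>R k) + f v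
       = t * t * D (D f h) k (v + \<sigma> *\<^sub>R h + \<tau> *\<^sub>R k)"
proof -
  have line: "((\<lambda>s. g (p + s *\<^sub>R u)) has_derivative (\<lambda>r. r * D g u (p + s *\<^sub>R u))) (at s within X)"
    if "g differentiable (at (p + s *\<^sub>R u))" for g :: "'a \<Rightarrow> real" and p u s X
  proof -
    let ?g' = "frechet_derivative g (at (p + s *\<^sub>R u))"
    have g': "(g has_derivative ?g') (at (p + s *\<^sub>R u))"
      using that by (simp add: frechet_derivative_works)
    have "((\<lambda>s. g (p + s *\<^sub>R u)) has_derivative (\<lambda>r. ?g' (r *\<^sub>R u))) (at s within X)"
      by (rule has_derivative_compose[where f = "\<lambda>s. p + s *\<^sub>R u", OF _ g']) (auto intro!: derivative_eq_intros)
    moreover have "?g' (r *\<^sub>R u) = r * ?g' u" for r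
      using has_derivative_linear[OF g'] by (simp add: linear_cmul)
    ultimately show ?thesis
      by (simp add: D_def)
  qed
  let ?g = "\<lambda>s. f ((v + t *\<^sub>R k) + s *\<^sub>R h) - f (v + s *\<^sub>R h)"
  have "\<exists>\<sigma>\<in>{0<..<t}. ?g t - ?g 0
      = (t - 0) * D f h ((v + t *\<^sub>R k) + \<sigma> *\<^sub>R h) - (t - 0) * D f h (v + \<sigma> *\<^sub>R h)"
  proof (rule mvt_simple[OF \<open>0 < t\<close>], intro has_derivative_diff line)
    fix s assume "0 \<le> s" "s \<le> t"
    then show "f differentiable (at ((v + t *\<^sub>R k) + s *\<^sub>R h))"
      using S[of s t] \<open>0 < t\<close> f by (simp add: algebra_simps)
    show "f differentiable (at (v + s *\<^sub>R h))"
      using S[of s 0] \<open>0 < t\<close> \<open>0 \<le> s\<close> \<open>s \<le> t\<close> f by simp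
  qed
  then obtain \<sigma> where \<sigma>: "\<sigma> \<in> {0<..<t}"
    "?g t - ?g 0 = t * (D f h ((v + \<sigma> *\<^sub>R h) + t *\<^sub>R k) - D f h ((v + \<sigma> *\<^sub>R h) + 0 *\<^sub>R k))"
    by (auto simp: algebra_simps)
  have "\<exists>\<tau>\<in>{0<..<t}. D f h ((v + \<sigma> *\<^sub>R h) + t *\<^sub>R k) - D f h ((v + \<sigma> *\<^sub>R h) + 0 *\<^sub>R k)
      = (t - 0) * D (D f h) k ((v + \<sigma> *\<^sub>R h) + \<tau> *\<^sub>R k)"
  proof (rule mvt_simple[OF \<open>0 < t\<close>], intro line)
    fix s assume "0 \<le> s" "s \<le> t"
    then show "D f h differentiable (at ((v + \<sigma> *\<^sub>R h) + s *\<^sub>R k))"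
      using S[of \<sigma> s] \<sigma> Df by simp
  qed
  then obtain \<tau> where "\<tau> \<in> {0<..<t}"
    "D f h ((v + \<sigma> *\<^sub>R h) + t *\<^sub>R k) - D f h ((v + \<sigma> *\<^sub>R h) + 0 *\<^sub>R k)
      = t * D (D f h) k ((v + \<sigma> *\<^sub>R h) + \<tau> *\<^sub>R k)"
    by auto
  with \<sigma> show thesis
    by (intro that[of \<sigma> \<tau>]) (auto simp: algebra_simps)
qed

text \<open>The second difference is symmetric in \<open>h\<close> and \<open>k\<close>, so on each
  small parallelogram the two mixed derivatives share a value, possibly at different points. If they
  differed at \<open>v\<close>, continuity would keep their values in disjoint open sets near
  \<open>v\<close>.\<close>

lemma second_derivative_symmetric:
  fixes f :: "'a::real_normed_vector \<Rightarrow> real"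
  defines "D \<equiv> \<lambda>f h v. frechet_derivative f (at v) h"
  assumes "open S" "v \<in> S"
    and f: "\<And>x. x \<in> S \<Longrightarrow> f differentiable (at x)"
    and Df: "\<And>x. x \<in> S \<Longrightarrow> D f h differentiable (at x)" "\<And>x. x \<in> S \<Longrightarrow> D f k differentiable (at x)"
    and cont: "continuous_on S (D (D f h) k)" "continuous_on S (D (D f k) h)"
  shows "D (D f h) k v = D (D f k) h v"
proof (rule ccontr)
  let ?P = "D (D f h) k" and ?Q = "D (D f k) h"
  assume "?P v \<noteq> ?Q v"
  then obtain A B where AB: "open A" "open B" "?P v \<in> A" "?Q v \<in> B" "A \<inter> B = {}"
    by (metis hausdorff)
  have "open (S \<inter> ?P -` A)" "open (S \<inter> ?Q -` B)"
    using cont \<open>open S\<close> AB by (auto simp: continuous_on_open_vimage Int_commute)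
  then have "open ((S \<inter> ?P -` A) \<inter> (S \<inter> ?Q -` B))"
    by (rule open_Int)
  moreover have "v \<in> (S \<inter> ?P -` A) \<inter> (S \<inter> ?Q -` B)"
    using AB \<open>v \<in> S\<close> by auto
  ultimately obtain e where e: "e > 0" "ball v e \<subseteq> (S \<inter> ?P -` A) \<inter> (S \<inter> ?Q -` B)"
    by (meson openE)
  \<comment> \<open>Small enough that the parallelogram with sides \<open>t *\<^sub>R h\<close> and
    \<open>t *\<^sub>R k\<close> stays in the ball; the summand 1 keeps the denominator positive
    when both vectors vanish.\<close>
  define t where "t = e / (norm h + norm k + 1)"
  have pos: "norm h + norm k + 1 > 0"
    by (simp add: add_nonneg_pos)
  then have "t > 0"
    using e by (simp add: t_def)
  have in_ball: "v + \<sigma> *\<^sub>R h + \<tau> *\<^sub>R k \<in> ball v e" if "\<sigma> \<in> {0..t}" "\<tau> \<in> {0..t}" for \<sigma> \<tau>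
  proof -
    have "norm (\<sigma> *\<^sub>R h + \<tau> *\<^sub>R k) \<le> \<sigma> * norm h + \<tau> * norm k"
      using that by (intro norm_triangle_le) simp
    also have "\<dots> \<le> t * norm h + t * norm k"
      using that by (intro add_mono mult_right_mono) auto
    also have "\<dots> < t * (norm h + norm k + 1)"
      using \<open>t > 0\<close> by (simp add: algebra_simps)
    also have "\<dots> = e"
      using pos by (simp add: t_def)
    finally have "norm (\<sigma> *\<^sub>R h + \<tau> *\<^sub>R k) < e" .
    moreover have "dist v (v + \<sigma> *\<^sub>R h + \<tau> *\<^sub>R k) = norm (\<sigma> *\<^sub>R h + \<tau> *\<^sub>R k)"
      by (metis add.assoc dist_add_cancel dist_0_norm add.right_neutral)
    ultimately show ?thesis
      by simp
  qed
  have in_S: "v + \<sigma> *\<^sub>R h + \<tau> *\<^sub>R k \<in> S" "v + \<tau> *\<^sub>R k + \<sigma> *\<^sub>R h \<in> S"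
    "v + \<tau> *\<^sub>R k + \<sigma> *\<^sub>R h \<in> ball v e"
    if "\<sigma> \<in> {0..t}" "\<tau> \<in> {0..t}" for \<sigma> \<tau>
    using in_ball[OF that] e(2) by (auto simp: add_ac)
  obtain \<sigma> \<tau> where 1: "\<sigma> \<in> {0..t}" "\<tau> \<in> {0..t}"
    "f (v + t *\<^sub>R h + t *\<^sub>R k) - f (v + t *\<^sub>R h) - f (v + t *\<^sub>R k) + f v
       = t * t * ?P (v + \<sigma> *\<^sub>R h + \<tau> *\<^sub>R k)"
    using second_difference_mvt[OF \<open>t > 0\<close> in_S(1) f Df(1)[unfolded D_def]] unfolding D_def by blast
  obtain \<tau>' \<sigma>' where 2: "\<tau>' \<in> {0..t}" "\<sigma>' \<in> {0..t}"
    "f (v + t *\<^sub>R k + t *\<^sub>R h) - f (v + t *\<^sub>R k) - f (v + t *\<^sub>R h) + f v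
       = t * t * ?Q (v + \<tau>' *\<^sub>R k + \<sigma>' *\<^sub>R h)"
    using second_difference_mvt[OF \<open>t > 0\<close> in_S(2) f Df(2)[unfolded D_def]] unfolding D_def by blast
  have swap: "v + t *\<^sub>R k + t *\<^sub>R h = v + t *\<^sub>R h + t *\<^sub>R k"
    by simp
  have "t * t * ?P (v + \<sigma> *\<^sub>R h + \<tau> *\<^sub>R k) = t * t * ?Q (v + \<tau>' *\<^sub>R k + \<sigma>' *\<^sub>R h)"
    using 1(3) 2(3) unfolding swap by linarith
  then have "?P (v + \<sigma> *\<^sub>R h + \<tau> *\<^sub>R k) = ?Q (v + \<tau>' *\<^sub>R k + \<sigma>' *\<^sub>R h)"
    using \<open>t > 0\<close> by simp
  moreover have "?P (v + \<sigma> *\<^sub>R h + \<tau> *\<^sub>R k) \<in> A"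
    using in_ball[OF 1(1,2)] e(2) by auto
  moreover have "?Q (v + \<tau>' *\<^sub>R k + \<sigma>' *\<^sub>R h) \<in> B"
    using in_S(3)[OF 2(2,1)] e(2) by auto
  ultimately show False
    using AB(5) by auto
qed

section \<open>Binomial coefficients\<close>

text \<open>Induction by the ratio of consecutive binomial coefficients; for \<open>i > n\<close>
  both sides are zero, the factor at \<open>s = n + 1\<close> being zero.\<close>

lemma prod_shifted_eq_binomial:
  "(\<Prod>s=1..i. (real n + 1 - real s) / real s) = real (n choose i)"
proof (induction i)
  case (Suc i)
  have "(\<Prod>s=1..Suc i. (real n + 1 - real s) / real s)
      = real (n choose i) * ((real n + 1 - real (Suc i)) / real (Suc i))"
    using Suc.IH by (simp add: prod.cl_ivl_Suc)
  also have "\<dots> = real (n choose Suc i)"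
  proof (cases "i \<le> n")
    case True
    have "(Suc i) * (n choose Suc i) = (n - i) * (n choose i)"
      by (simp only: binomial_absorption binomial_absorb_comp)
    then have "real (Suc i) * real (n choose Suc i) = real (n - i) * real (n choose i)"
      by (metis of_nat_mult)
    then show ?thesis
      using True by (simp add: field_simps of_nat_diff)
  qed (simp add: binomial_eq_0)
  finally show ?case .
qed simp

text \<open>For \<open>k = Suc n\<close> the two products are binomial coefficients of row
  \<open>n\<close>. Pascal's rule lifts both to row \<open>k\<close> by adding the same number, by
  symmetry of row \<open>n\<close>. The exceptional value \<open>C_coeff 1 0 = 1\<close> fits as
  well.\<close>

lemma C_coeff_eq_binomial:
  assumes "i \<le> k"
  shows "C_coeff (Suc k) i = real (k choose i) - real (k choose (Suc k - i))"
proof (cases k)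
  case 0
  then show ?thesis using assms by (simp add: C_coeff_def)
next
  case (Suc n)
  have "C_coeff (Suc k) i = real (n choose i) - real (n choose (Suc k - i))"
    using Suc prod_shifted_eq_binomial[of n i] prod_shifted_eq_binomial[of n "Suc k - i"]
    by (simp add: C_coeff_def algebra_simps)
  moreover have "(k choose i) + (n choose (Suc k - i)) = (n choose i) + (k choose (Suc k - i))"
  proof (cases i)
    case 0
    then show ?thesis using Suc by simp
  next
    case i: (Suc j)
    have "n choose j = n choose (n - j)"
      using assms i Suc by (intro binomial_symmetric) simp
    moreover have "Suc k - i = Suc (n - j)"
      using assms i Suc by simp
    ultimately show ?thesis
      using i Suc by simp
  qed
  then have "real (k choose i) + real (n choose (Suc k - i)) = real (n choose i) + real (k choose (Suc k - i))"
    by (metis of_nat_add)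
  ultimately show ?thesis by linarith
qed

text \<open>The terms at \<open>m\<close> and \<open>Suc k - m\<close> carry opposite values of
  \<open>w\<close>; reflecting the upper half onto the lower one leaves differences of binomial
  coefficients.\<close>

lemma sum_binomial_fold_antisymmetric:
  fixes w :: "nat \<Rightarrow> nat \<Rightarrow> real"
  assumes anti: "\<And>m n. w m n = - w n m"
  shows "(\<Sum>m\<le>k. real (k choose m) * w m (Suc k - m))
       = (\<Sum>i=0..k div 2. C_coeff (Suc k) i * w i (Suc k - i))"
proof -
  let ?g = "\<lambda>m. real (k choose m) * w m (Suc k - m)"
  let ?h = "\<lambda>i. real (k choose (Suc k - i)) * w i (Suc k - i)"
  have diag: "w m m = 0" for m
    using anti[of m m] by simp
  have "(\<Sum>m\<le>k. ?g m) = sum ?g {0..k div 2} + sum ?g {k div 2 + 1..k}"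
    by (subst sum.union_disjoint[symmetric]) (auto intro!: sum.cong)
  also have "sum ?g {k div 2 + 1..k} = (\<Sum>i\<in>{1..k - k div 2}. - ?h i)"
    by (rule sum.reindex_bij_witness[of _ "\<lambda>i. Suc k - i" "\<lambda>i. Suc k - i"])
      (auto simp: anti[of _ "Suc k - _"] intro!: anti)
  \<comment> \<open>The ranges differ only by zero terms: at \<open>i = 0\<close> the coefficient is
    \<open>k choose Suc k\<close>, and for odd \<open>k\<close> the extra midpoint lies on the
    diagonal of \<open>w\<close>.\<close>
  also have "\<dots> = (\<Sum>i\<in>{0..k div 2}. - ?h i)"
  proof (cases "even k")
    case True
    then have "{0..k div 2} = insert 0 {1..k - k div 2}"
      by (auto elim!: evenE)
    then show ?thesis by simp
  next
    case False
    then obtain n where n: "k = 2 * n + 1" by (elim oddE)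
    have "{1..k - k div 2} = insert (Suc n) {1..n}"
      using n by auto
    moreover have "{0..k div 2} = insert 0 {1..n}"
      using n by auto
    ultimately show ?thesis
      using diag[of "Suc n"] n by (simp add: binomial_eq_0 del: binomial_Suc_Suc)
  qed
  also have "sum ?g {0..k div 2} + \<dots> = (\<Sum>i=0..k div 2. C_coeff (Suc k) i * w i (Suc k - i))"
    unfolding sum.distrib[symmetric]
    by (intro sum.cong refl) (simp add: C_coeff_eq_binomial algebra_simps)
  finally show ?thesis .
qed

section \<open>Components of forms\<close>

text \<open>Has the same shape as \<open>wedge_expansion\<close>, so that equations between
  two-forms reduce to their components.\<close>

lemma ext_deriv_expansion:
  "ext_deriv \<omega> v x y = (\<Sum>i\<in>UNIV. \<Sum>j\<in>UNIV. x $ i * y $ j *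
     (partial_deriv i (coeff \<omega> j) v - partial_deriv j (coeff \<omega> i) v))"
proof -
  have "ext_deriv \<omega> v x y =
      (\<Sum>i\<in>UNIV. \<Sum>j\<in>UNIV. x $ j * y $ i * partial_deriv j (coeff \<omega> i) v)
    - (\<Sum>i\<in>UNIV. \<Sum>j\<in>UNIV. x $ i * y $ j * partial_deriv j (coeff \<omega> i) v)"
    by (simp add: ext_deriv_def covector_wedge_def dv.rep_eq algebra_simps sum_subtractf)
  also have "(\<Sum>i\<in>UNIV. \<Sum>j\<in>UNIV. x $ j * y $ i * partial_deriv j (coeff \<omega> i) v)
    = (\<Sum>i\<in>UNIV. \<Sum>j\<in>UNIV. x $ i * y $ j * partial_deriv i (coeff \<omega> j) v)"
    by (rule sum.swap)
  finally show ?thesis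
    by (simp add: algebra_simps sum_subtractf)
qed

lemma wedge_expansion:
  "wedge \<alpha> \<beta> v x y = (\<Sum>i\<in>UNIV. \<Sum>j\<in>UNIV. x $ i * y $ j *
     (coeff \<alpha> i v * coeff \<beta> j v - coeff \<beta> i v * coeff \<alpha> j v))"
proof -
  have apply_eq: "\<omega> v z = (\<Sum>i\<in>UNIV. coeff \<omega> i v * z $ i)" for \<omega> :: "'a one_form" and z
    by (subst one_form_expansion) (simp add: blinfun.sum_left blinfun.scaleR_left dv.rep_eq)
  show ?thesis
    unfolding wedge_def covector_wedge_def apply_eq[of _ x] apply_eq[of _ y] sum_product
    by (simp add: algebra_simps sum_subtractf)
qed

lemma coeff_sum_dv: "coeff (\<lambda>v. \<Sum>i\<in>UNIV. c i v *\<^sub>R dv i) j = c j"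
  by (rule ext) (simp add: coeff_def blinfun.sum_left blinfun.scaleR_left dv.rep_eq axis_def if_distrib cong: if_cong)

lemma ext_deriv_axis:
  "ext_deriv \<omega> v (axis i 1) (axis j 1) = partial_deriv i (coeff \<omega> j) v - partial_deriv j (coeff \<omega> i) v"
  unfolding ext_deriv_expansion axis_def
  by (simp add: if_distrib[of "\<lambda>c. c * _"] if_distrib[of "\<lambda>c. _ * c"] sum.delta' cong: if_cong)

lemma wedge_axis:
  "wedge \<alpha> \<beta> v (axis i 1) (axis j 1) = coeff \<alpha> i v * coeff \<beta> j v - coeff \<beta> i v * coeff \<alpha> j v"
  by (simp add: wedge_def covector_wedge_def coeff_def)

section \<open>The generating equation\<close>

definition egf :: "(nat \<Rightarrow> real) \<Rightarrow> real fps" where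
  "egf p = Abs_fps (\<lambda>k. p k / fact k)"

text \<open>The derivative shifts the second index, so the indices add up to \<open>Suc k\<close>
  while the binomial row stays \<open>k\<close>, as in the unfolded system.\<close>

lemma fps_nth_egf_mult_deriv:
  "fps_nth (egf p * fps_deriv (egf q)) k
     = (\<Sum>m\<le>k. real (k choose m) * (p m * q (Suc k - m))) / fact k"
proof -
  have "p m / fact m * (real (Suc (k - m)) * (q (Suc (k - m)) / fact (Suc (k - m))))
      = real (k choose m) * (p m * q (Suc k - m)) / fact k" if "m \<le> k" for m
    using that by (simp add: binomial_fact Suc_diff_le divide_simps del: of_nat_Suc)
  then show ?thesis
    by (simp add: egf_def fps_mult_nth atLeast0AtMost sum_divide_distrib del: of_nat_Suc)
qed

text \<open>\<open>d l i\<close> stands for the \<open>l\<close>-th partial derivative of \<open>w i\<close>, so \<open>E = dw - w \<and> w'\<close>, while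
  \<open>D l i j\<close> is the \<open>l\<close>-th partial derivative of the \<open>(i, j)\<close> component of \<open>w \<and> w'\<close>.  In forms:
  \<open>d(w \<and> w') = E \<and> w' - E' \<and> w\<close>, since the terms free of \<open>E\<close> cancel.\<close>

lemma fps_Bianchi:
  fixes w :: "'i \<Rightarrow> 'a::comm_ring_1 fps" and d :: "'i \<Rightarrow> 'i \<Rightarrow> 'a fps"
  defines "E \<equiv> \<lambda>i j. d i j - d j i - (w i * fps_deriv (w j) - w j * fps_deriv (w i))"
    and "D \<equiv> \<lambda>l i j. (d l i * fps_deriv (w j) + w i * fps_deriv (d l j))
                  - (d l j * fps_deriv (w i) + w j * fps_deriv (d l i))"
  shows "D l i j + D i j l + D j l i =
      (E l i * fps_deriv (w j) - fps_deriv (E l i) * w j)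
    + (E i j * fps_deriv (w l) - fps_deriv (E i j) * w l)
    + (E j l * fps_deriv (w i) - fps_deriv (E j l) * w i)"
  unfolding E_def D_def by (simp add: algebra_simps)

text \<open>Up to the factor \<open>k!\<close>, the coefficient of \<open>t\<^sup>k\<close> in the \<open>(i, j)\<close> component of
  \<open>d\<omega> - \<omega> \<and> \<omega>'\<close>, where \<open>\<omega>(t) = \<Sum>k. a\<^sub>k t\<^sup>k / k!\<close> and \<open>a k i\<close> is the \<open>i\<close>-th component of \<open>a\<^sub>k\<close>.\<close>

definition mc_defect :: "(nat \<Rightarrow> 'n::finite \<Rightarrow> real^'n \<Rightarrow> real) \<Rightarrow> nat \<Rightarrow> 'n \<Rightarrow> 'n \<Rightarrow> real^'n \<Rightarrow> real" where
  "mc_defect a k i j v = partial_deriv i (a k j) v - partial_deriv j (a k i) v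
     - ((\<Sum>m\<le>k. real (k choose m) * (a m i v * a (Suc k - m) j v))
      - (\<Sum>m\<le>k. real (k choose m) * (a m j v * a (Suc k - m) i v)))"

lemma mc_defect_antisym: "mc_defect a k i j v = - mc_defect a k j i v"
  by (simp add: mc_defect_def)

section \<open>Compatibility of the defects from d d = 0\<close>

lemma partial_deriv_eqI: "(f has_derivative f') (at v) \<Longrightarrow> partial_deriv l f v = f' (axis l 1)"
  unfolding partial_deriv_def by (metis frechet_derivative_at)

lemma smooth_on_partial_deriv: "smooth_on f U \<Longrightarrow> smooth_on (partial_deriv j f) U"
  unfolding partial_deriv_def[abs_def] by (rule smooth_on_frechet_derivative)

lemma partial_deriv_commute:
  assumes "open U" "smooth_on f U" "v \<in> U"
  shows "partial_deriv i (partial_deriv j f) v = partial_deriv j (partial_deriv i f) v"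
proof -
  have "smooth_on (\<lambda>v. frechet_derivative f (at v) h) U"
    "smooth_on (\<lambda>v. frechet_derivative (\<lambda>v. frechet_derivative f (at v) h) (at v) k) U" for h k
    using assms(2) by (blast intro: smooth_on_frechet_derivative)+
  with assms show ?thesis
    unfolding partial_deriv_def[abs_def]
    by (intro second_derivative_symmetric[OF assms(1,3)])
      (blast intro: smooth_on_differentiable smooth_on_continuous)+
qed

lemma smooth_on_mc_defect:
  assumes "open U" "\<And>k i. smooth_on (a k i) U"
  shows "smooth_on (mc_defect a k i j) U"
  unfolding mc_defect_def[abs_def]
  by (intro smooth_on_diff smooth_on_sum smooth_on_mult smooth_on_const smooth_on_partial_deriv assms)

text \<open>The product rule applied to the binomial sums gives coefficients of the series
  \<open>D\<close> in \<open>fps_Bianchi\<close>, which makes that identity available for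
  defects.\<close>

lemma partial_deriv_mc_defect:
  assumes "\<And>k i. smooth_on (a k i) U" "v \<in> U"
  defines "w \<equiv> \<lambda>i. egf (\<lambda>k. a k i v)" and "d \<equiv> \<lambda>l i. egf (\<lambda>k. partial_deriv l (a k i) v)"
  shows "partial_deriv l (mc_defect a k i j) v =
      partial_deriv l (partial_deriv i (a k j)) v - partial_deriv l (partial_deriv j (a k i)) v
    - fact k * fps_nth ((d l i * fps_deriv (w j) + w i * fps_deriv (d l j))
                  - (d l j * fps_deriv (w i) + w j * fps_deriv (d l i))) k"
proof -
  let ?D = "\<lambda>f. frechet_derivative f (at v)"
  have D: "(f has_derivative ?D f) (at v)" if "smooth_on f U" for f :: "real^'a \<Rightarrow> real"
    using smooth_on_differentiable[OF that \<open>v \<in> U\<close>] by (simp add: frechet_derivative_works)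
  have "(mc_defect a k i j has_derivative (\<lambda>h. ?D (partial_deriv i (a k j)) h - ?D (partial_deriv j (a k i)) h
      - ((\<Sum>m\<le>k. real (k choose m) * (a m i v * ?D (a (Suc k - m) j) h + ?D (a m i) h * a (Suc k - m) j v))
       - (\<Sum>m\<le>k. real (k choose m) * (a m j v * ?D (a (Suc k - m) i) h + ?D (a m j) h * a (Suc k - m) i v))))) (at v)"
    unfolding mc_defect_def[abs_def]
    by (intro has_derivative_diff has_derivative_sum has_derivative_mult_right has_derivative_mult
        D assms smooth_on_partial_deriv)
  from partial_deriv_eqI[OF this, of l] show ?thesis
    unfolding w_def d_def fps_sub_nth fps_add_nth fps_nth_egf_mult_deriv
    by (simp add: partial_deriv_def[symmetric] sum.distrib algebra_simps)
qed

text \<open>Take the coefficient of order \<open>n\<close> in \<open>fps_Bianchi\<close>: the left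
  side vanishes by symmetry of second derivatives, and on the right only the defect of order
  \<open>Suc n\<close> survives, through the derivative of \<open>E\<close>.\<close>

lemma mc_defect_cyclic:
  assumes "open U" and smooth: "\<And>k i. smooth_on (a k i) U"
    and vanish: "\<And>k i j v. k \<le> n \<Longrightarrow> v \<in> U \<Longrightarrow> mc_defect a k i j v = 0"
    and "v \<in> U"
  shows "a 0 l v * mc_defect a (Suc n) i j v + a 0 i v * mc_defect a (Suc n) j l v
       + a 0 j v * mc_defect a (Suc n) l i v = 0"
proof -
  define w where "w = (\<lambda>i. egf (\<lambda>k. a k i v))"
  define d where "d = (\<lambda>l i. egf (\<lambda>k. partial_deriv l (a k i) v))"
  define E where "E = (\<lambda>i j. d i j - d j i - (w i * fps_deriv (w j) - w j * fps_deriv (w i)))"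
  define D where "D = (\<lambda>l i j. (d l i * fps_deriv (w j) + w i * fps_deriv (d l j))
                  - (d l j * fps_deriv (w i) + w j * fps_deriv (d l i)))"
  have E_nth: "fps_nth (E i j) k = mc_defect a k i j v / fact k" for i j k
    unfolding E_def d_def w_def mc_defect_def fps_sub_nth fps_nth_egf_mult_deriv
    by (simp add: egf_def diff_divide_distrib)
  have D_nth: "fps_nth (D l i j) n = (partial_deriv l (partial_deriv i (a n j)) v
      - partial_deriv l (partial_deriv j (a n i)) v) / fact n" for l i j
  proof -
    \<comment> \<open>The defect vanishes on all of the open set \<open>U\<close>, hence so does its
      derivative; only second derivatives of \<open>a n\<close> remain in \<open>D\<close>.\<close>
    have "(mc_defect a n i j has_derivative (\<lambda>h. 0)) (at v)"
      by (rule has_derivative_transform_within_open[OF _ \<open>open U\<close> \<open>v \<in> U\<close>, of "\<lambda>x. 0"])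
        (simp_all add: vanish)
    then have "partial_deriv l (mc_defect a n i j) v = 0"
      by (simp add: partial_deriv_eqI)
    then show ?thesis
      using partial_deriv_mc_defect[OF smooth \<open>v \<in> U\<close>, where l = l and k = n and i = i and j = j] unfolding D_def w_def d_def
      by (simp add: field_simps)
  qed
  have "fps_nth (D l i j + D i j l + D j l i) n = 0"
    using partial_deriv_commute[OF \<open>open U\<close> smooth \<open>v \<in> U\<close>]
    by (simp add: D_nth diff_divide_distrib)
  then have "fps_nth ((E l i * fps_deriv (w j) - fps_deriv (E l i) * w j)
    + (E i j * fps_deriv (w l) - fps_deriv (E i j) * w l)
    + (E j l * fps_deriv (w i) - fps_deriv (E j l) * w i)) n = 0"
    unfolding D_def E_def fps_Bianchi .
  \<comment> \<open>\<open>E\<close> has no coefficients below order \<open>Suc n\<close>, so the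
    second product keeps only its last term; the factor \<open>Suc n\<close> from differentiation
    turns \<open>fact (Suc n)\<close> into \<open>fact n\<close>.\<close>
  moreover have "fps_nth (E i j * fps_deriv (w l) - fps_deriv (E i j) * w l) n
      = - (a 0 l v * mc_defect a (Suc n) i j v / fact n)" for i j l
  proof -
    have "fps_nth (E i j * fps_deriv (w l)) n = 0"
      using vanish[OF _ \<open>v \<in> U\<close>] by (simp add: fps_mult_nth E_nth)
    moreover have "fps_nth (fps_deriv (E i j) * w l) n
        = (\<Sum>m=0..n. if m = n then mc_defect a (Suc n) i j v / fact n * a 0 l v else 0)"
      unfolding fps_mult_nth
      using vanish[OF _ \<open>v \<in> U\<close>]
      by (intro sum.cong) (auto simp: E_nth w_def egf_def simp del: of_nat_Suc)
    ultimately show ?thesis by simp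
  qed
  ultimately have "(a 0 l v * mc_defect a (Suc n) i j v + a 0 i v * mc_defect a (Suc n) j l v
       + a 0 j v * mc_defect a (Suc n) l i v) / fact n = 0"
    by (simp add: add_divide_distrib)
  then show ?thesis by simp
qed

text \<open>If \<open>L \<and> e = 0\<close>, then \<open>e = L \<and> (\<iota>\<^sub>X e)\<close> for any vector \<open>X\<close> with \<open>L X = 1\<close>.\<close>

lemma wedge_division:
  fixes L X :: "'n::finite \<Rightarrow> real"
  assumes cyc: "\<And>l. L l * e i j + L i * e j l + L j * e l i = 0"
    and anti: "\<And>i j. e i j = - e j i"
    and "(\<Sum>l\<in>UNIV. X l * L l) = 1"
  shows "e i j = L i * (\<Sum>l\<in>UNIV. X l * e l j) - L j * (\<Sum>l\<in>UNIV. X l * e l i)"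
proof -
  have "e i j = (\<Sum>l\<in>UNIV. X l * L l) * e i j"
    using assms(3) by simp
  also have "\<dots> = (\<Sum>l\<in>UNIV. X l * (L i * e l j - L j * e l i))"
    unfolding sum_distrib_right
  proof (intro sum.cong refl)
    fix l
    have "L l * e i j = L i * e l j - L j * e l i"
      using cyc[of l] anti[of j l] by simp
    then show "X l * L l * e i j = X l * (L i * e l j - L j * e l i)"
      by (simp add: mult.assoc)
  qed
  finally show ?thesis
    by (simp add: algebra_simps sum_subtractf sum_distrib_left)
qed

section \<open>Inductive construction of the sequence\<close>

lemma mc_defect_cong:
  "(\<And>m. m \<le> Suc k \<Longrightarrow> a m = b m) \<Longrightarrow> mc_defect a k i j v = mc_defect b k i j v"
  by (simp add: mc_defect_def)

text \<open>Only at \<open>m = 0\<close> does \<open>Suc k - m\<close> equal \<open>Suc k\<close>,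
  and there the binomial coefficient is 1, so the change enters as the component of the wedge of
  \<open>a 0\<close> with \<open>b\<close>.\<close>

lemma mc_defect_update:
  assumes "0 < k"
  shows "mc_defect (a(Suc k := \<lambda>i v. a (Suc k) i v + b i v)) k i j v
       = mc_defect a k i j v - (a 0 i v * b j v - a 0 j v * b i v)"
proof -
  have "(\<Sum>m\<le>k. real (k choose m) * ((a(Suc k := \<lambda>i v. a (Suc k) i v + b i v)) m i v
          * (a(Suc k := \<lambda>i v. a (Suc k) i v + b i v)) (Suc k - m) j v))
      = (\<Sum>m\<le>k. real (k choose m) * (a m i v * a (Suc k - m) j v) + (if m = 0 then a 0 i v * b j v else 0))"
    for i j
    by (intro sum.cong) (auto simp: algebra_simps)
  then show ?thesis
    using assms by (simp add: mc_defect_def sum.distrib)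
qed

text \<open>Defects of order at most \<open>n\<close> involve entries up to \<open>Suc n\<close>
  only, so entry \<open>n + 2\<close> is free to absorb the defect of order
  \<open>Suc n\<close>.\<close>

lemma mc_step:
  fixes a :: "nat \<Rightarrow> 'n::finite \<Rightarrow> real^'n \<Rightarrow> real"
  assumes "open U" and smooth: "\<And>k i. smooth_on (a k i) U"
    and nz: "\<And>v. v \<in> U \<Longrightarrow> \<exists>i. a 0 i v \<noteq> 0"
    and vanish: "\<And>k i j v. k \<le> n \<Longrightarrow> v \<in> U \<Longrightarrow> mc_defect a k i j v = 0"
  obtains a' :: "nat \<Rightarrow> 'n \<Rightarrow> real^'n \<Rightarrow> real"
  where "\<And>k. k \<le> Suc n \<Longrightarrow> a' k = a k" "\<And>k i. smooth_on (a' k i) U"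
    "\<And>k i j v. k \<le> Suc n \<Longrightarrow> v \<in> U \<Longrightarrow> mc_defect a' k i j v = 0"
proof
  \<comment> \<open>\<open>N\<close> is the squared Euclidean length of L, nonzero on
    \<open>U\<close>. Dividing L by \<open>N\<close> gives a smooth vector field X with L X = 1, and
    \<open>b\<close> is the contraction of the defect with X, as in
    \<open>wedge_division\<close>.\<close>
  define N where "N = (\<lambda>v. \<Sum>l\<in>UNIV. a 0 l v * a 0 l v)"
  define b where "b = (\<lambda>j v. \<Sum>l\<in>UNIV. a 0 l v * inverse (N v) * mc_defect a (Suc n) l j v)"
  define a' where "a' = a(Suc (Suc n) := \<lambda>i v. a (Suc (Suc n)) i v + b i v)"
  have N: "N v \<noteq> 0" if "v \<in> U" for v
    using nz[OF that] by (simp add: N_def sum_nonneg_eq_0_iff)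
  have smooth_N: "smooth_on N U"
    unfolding N_def by (intro smooth_on_sum smooth_on_mult smooth \<open>open U\<close>)
  have "smooth_on (b j) U" for j
    unfolding b_def
    by (intro smooth_on_sum smooth_on_mult smooth_on_inverse smooth_N N smooth smooth_on_mc_defect \<open>open U\<close>)
  then show "smooth_on (a' k i) U" for k i
    using smooth \<open>open U\<close> by (auto simp: a'_def intro: smooth_on_add)
  show a'_eq: "a' k = a k" if "k \<le> Suc n" for k
    using that by (simp add: a'_def)
  show "mc_defect a' k i j v = 0" if "k \<le> Suc n" "v \<in> U" for k i j v
  proof (cases "k = Suc n")
    case True
    have "(\<Sum>l\<in>UNIV. a 0 l v * inverse (N v) * a 0 l v) = N v * inverse (N v)"
      unfolding N_def sum_distrib_right by (simp add: mult_ac)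
    then have "mc_defect a (Suc n) i j v = a 0 i v * b j v - a 0 j v * b i v"
      unfolding b_def using N[OF \<open>v \<in> U\<close>]
      by (intro wedge_division[where e = "\<lambda>i j. mc_defect a (Suc n) i j v"] mc_defect_antisym
          mc_defect_cyclic[OF \<open>open U\<close> smooth vanish \<open>v \<in> U\<close>]) simp_all
    then show ?thesis
      unfolding True a'_def by (subst mc_defect_update) simp_all
  next
    case False
    then show ?thesis
      using that vanish[of k v i j] mc_defect_cong[of k a' a] a'_eq by simp
  qed
qed

text \<open>Dependent choice yields stages of which each keeps the entries of its predecessor
  \<open>n\<close> up to index \<open>Suc n\<close>; every entry stabilises, and the diagonal
  collects the stable values.\<close>

lemma mc_sequence_exists:
  fixes a :: "nat \<Rightarrow> 'n::finite \<Rightarrow> real^'n \<Rightarrow> real"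
  assumes "open U" and "\<And>k i. smooth_on (a k i) U"
    and nz: "\<And>v. v \<in> U \<Longrightarrow> \<exists>i. a 0 i v \<noteq> 0"
    and "\<And>i j v. v \<in> U \<Longrightarrow> mc_defect a 0 i j v = 0"
  obtains c :: "nat \<Rightarrow> 'n \<Rightarrow> real^'n \<Rightarrow> real"
  where "c 0 = a 0" "c 1 = a 1" "\<And>k i. smooth_on (c k i) U"
    "\<And>k i j v. v \<in> U \<Longrightarrow> mc_defect c k i j v = 0"
proof -
  define P where "P n s \<longleftrightarrow> s 0 = a 0 \<and> s 1 = a 1 \<and> (\<forall>k i. smooth_on (s k i) U) \<and>
      (\<forall>k\<le>n. \<forall>i j. \<forall>v\<in>U. mc_defect s k i j v = 0)"
    for n and s :: "nat \<Rightarrow> 'n \<Rightarrow> real^'n \<Rightarrow> real"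
  have "\<exists>f. \<forall>n. P n (f n) \<and> (\<forall>k\<le>Suc n. f (Suc n) k = f n k)"
  proof (rule dependent_nat_choice)
    show "\<exists>s. P 0 s"
      using assms by (auto simp: P_def)
  next
    fix s n assume s: "P n s"
    then obtain s' where "\<And>k. k \<le> Suc n \<Longrightarrow> s' k = s k" "\<And>k i. smooth_on (s' k i) U"
      "\<And>k i j v. k \<le> Suc n \<Longrightarrow> v \<in> U \<Longrightarrow> mc_defect s' k i j v = 0"
      using mc_step[of U s n] nz \<open>open U\<close> unfolding P_def by metis
    with s show "\<exists>s'. P (Suc n) s' \<and> (\<forall>k\<le>Suc n. s' k = s k)"
      by (intro exI[of _ s']) (auto simp: P_def)
  qed
  then obtain f where f: "\<And>n. P n (f n)" "\<And>n k. k \<le> Suc n \<Longrightarrow> f (Suc n) k = f n k"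
    by blast
  have stable: "f n k = f k k" if "k \<le> n" for n k
    using that by (induction n rule: dec_induct) (simp_all add: f(2))
  show thesis
  proof (rule that[of "\<lambda>k. f k k"])
    show "f 0 0 = a 0" "f 1 1 = a 1" "smooth_on (f k k i) U" for k i
      using f(1) by (auto simp: P_def)
    show "mc_defect (\<lambda>k. f k k) k i j v = 0" if "v \<in> U" for k i j v
    proof -
      \<comment> \<open>The defect of order \<open>k\<close> reaches entry \<open>Suc k\<close>, one
        beyond the range of \<open>stable\<close>; stage \<open>Suc k\<close> leaves that entry of
        stage \<open>k\<close> unchanged.\<close>
      have "f m m = f k m" if "m \<le> Suc k" for m
        using that stable[of m k] f(2)[of "Suc k" k] by (cases "m = Suc k") auto
      then have "mc_defect (\<lambda>k. f k k) k i j v = mc_defect (f k) k i j v"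
        by (intro mc_defect_cong)
      then show ?thesis
        using f(1)[of k] that by (simp add: P_def)
    qed
  qed
qed

section \<open>From component sequences back to differential forms\<close>

theorem theorem6p1:
  fixes U :: "(real^'n) set"
    and L A :: "'n::finite one_form"
  assumes dim: "CARD('n) \<ge> 3"
    and "open U"
    and "smooth_one_form L U"
    and "smooth_one_form A U"
    and "\<forall>v\<in>U. L v \<noteq> 0"
    and "\<forall>v\<in>U. ext_deriv L v = wedge L A v"
  shows "\<exists>\<A> :: nat \<Rightarrow> 'n one_form.
           \<A> 0 = L \<and> \<A> 1 = A \<and>
           (\<forall>k\<ge>2. smooth_one_form (\<A> k) U) \<and>
           (\<forall>k. \<forall>v\<in>U. \<forall>x y.
              ext_deriv (\<A> k) v x y =
              (\<Sum>i=0..k div 2. C_coeff (k + 1) i * wedge (\<A> i) (\<A> (k + 1 - i)) v x y))"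
proof -
  \<comment> \<open>Zero padding merely starts the induction: the defect of order 0 involves only
    the coefficients of \<open>L\<close> and \<open>A\<close>, and vanishes by the given
    equation.\<close>
  define a where "a k i = (if k = 0 then coeff L i else if k = 1 then coeff A i else (\<lambda>v. 0))"
    for k :: nat and i
  have "smooth_on (a k i) U" for k i
    using assms by (simp add: a_def smooth_one_form_def smooth_on_const)
  moreover have "\<exists>i. a 0 i v \<noteq> 0" if "v \<in> U" for v
  proof (rule ccontr)
    assume "\<nexists>i. a 0 i v \<noteq> 0"
    then have "L v = 0"
      using one_form_expansion[of L v] by (simp add: a_def)
    with that assms show False by simp
  qed
  moreover have "mc_defect a 0 i j v = 0" if "v \<in> U" for i j v
    using assms(6) that ext_deriv_axis[of L v i j] wedge_axis[of L A v i j]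
    by (simp add: mc_defect_def a_def mult.commute)
  ultimately obtain c where c: "c 0 = a 0" "c 1 = a 1" "\<And>k i. smooth_on (c k i) U"
    "\<And>k i j v. v \<in> U \<Longrightarrow> mc_defect c k i j v = 0"
    using mc_sequence_exists[OF \<open>open U\<close>] by metis
  define B where "B k v = (\<Sum>i\<in>UNIV. c k i v *\<^sub>R dv i)" for k v
  have coeff_B: "coeff (B k) i = c k i" for k i
    unfolding B_def[abs_def] by (rule coeff_sum_dv)
  have "B 0 = L" "B 1 = A"
    using c(1,2) by (auto simp: fun_eq_iff B_def a_def one_form_expansion[of L] one_form_expansion[of A])
  moreover have "smooth_one_form (B k) U" for k
    using c(3) by (simp add: smooth_one_form_def coeff_B)
  moreover have "ext_deriv (B k) v x y =
      (\<Sum>i=0..k div 2. C_coeff (k + 1) i * wedge (B i) (B (k + 1 - i)) v x y)" if "v \<in> U" for k v x y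
  proof -
    have "partial_deriv i (c k j) v - partial_deriv j (c k i) v
        = (\<Sum>m\<le>k. real (k choose m) * (c m i v * c (Suc k - m) j v - c (Suc k - m) i v * c m j v))" for i j
      using c(4)[OF that, of k i j] by (simp add: mc_defect_def algebra_simps sum_subtractf)
    then have "ext_deriv (B k) v x y = (\<Sum>i\<in>UNIV. \<Sum>j\<in>UNIV. \<Sum>m\<le>k. x $ i * y $ j *
        (real (k choose m) * (c m i v * c (Suc k - m) j v - c (Suc k - m) i v * c m j v)))"
      by (simp add: ext_deriv_expansion coeff_B sum_distrib_left)
    also have "\<dots> = (\<Sum>i\<in>UNIV. \<Sum>m\<le>k. \<Sum>j\<in>UNIV. x $ i * y $ j *
        (real (k choose m) * (c m i v * c (Suc k - m) j v - c (Suc k - m) i v * c m j v)))"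
      by (intro sum.cong refl sum.swap)
    also have "\<dots> = (\<Sum>m\<le>k. \<Sum>i\<in>UNIV. \<Sum>j\<in>UNIV. x $ i * y $ j *
        (real (k choose m) * (c m i v * c (Suc k - m) j v - c (Suc k - m) i v * c m j v)))"
      by (rule sum.swap)
    also have "\<dots> = (\<Sum>m\<le>k. real (k choose m) * wedge (B m) (B (Suc k - m)) v x y)"
      by (simp add: wedge_expansion coeff_B sum_distrib_left mult_ac)
    \<comment> \<open>Antisymmetry of the wedge product folds the full binomial sum to the required
      range.\<close>
    also have "\<dots> = (\<Sum>i=0..k div 2. C_coeff (Suc k) i * wedge (B i) (B (Suc k - i)) v x y)"
      by (rule sum_binomial_fold_antisymmetric) (simp add: wedge_def covector_wedge_def)
    finally show ?thesis by simp
  qed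
  ultimately show ?thesis by (intro exI[of _ B]) simp
qed

end
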